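(* Let $n\ge 3$ and $r\ge 1$ be integers, let $I_n=(x_ix_{i+1} : 1\le i\le n-1)\subseteq R_n$ be the edge ideal of the line graph (path) $L_n$ on $[n]$, and let $I_{n+r}:=\mathrm{Inc}(\mathbb{N})_{n,n+r}(I_n)\subseteq R_{n+r}$. Then $I_{n+r}$ is the ideal generated by the following monomials: (1) $x_ix_j$ for all integers $i,j$ with $1\le i\le n-2$ and $i<j\le i+r+1$; and (2) $x_ix_j$ for all integers $i,j$ with $n-1\le i\le n+r-1$ and $i<j\le n+r$.
   Context: Let $k$ be a field, $R_m=k[x_1,\dots,x_m]$ and $[m]=\{1,\dots,m\}$. For $n\le m$, $\mathrm{Inc}(\mathbb{N})_{n,m}$ is the set of strictly increasing functions $\pi:[n]\to[m]$; each such $\pi$ induces the $k$-algebra homomorphism $\pi:R_n\to R_m$, $x_i\mapsto x_{\pi(i)}$. For an ideal $I\subseteq R_n$, $\mathrm{Inc}(\mathbb{N})_{n,m}(I):=\sum_{\pi\in\mathrm{Inc}(\mathbb{N})_{n,m}}\pi(I)R_m$, the ideal of $R_m$ generated by the images of $I$ under all such $\pi$. The edge ideal of a simple graph $G$ on $[n]$ is $I(G)=(x_ix_j : \{i,j\}\in E(G))\subseteq R_n$. The line graph $L_n$ is the path on vertex set $[n]$ with edges $\{i,i+1\}$, $1\le i\le n-1$. *)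

theory Defs
  imports "HOL-Library.Poly_Mapping" "HOL-Library.FuncSet" "HOL-Algebra.Ideal"
begin

text \<open>
  A monomial is a finitely supported exponent vector \<open>nat \<Rightarrow>\<^sub>0 nat\<close>, and a polynomial is a
  finitely supported family of coefficients indexed by monomials. The library instances make
  this type the polynomial ring in the variables \<open>x\<^sub>0, x\<^sub>1, x\<^sub>2, \<dots>\<close>; the ring \<open>R\<^sub>m\<close> is
  its subring of polynomials in which only \<open>x\<^sub>1, \<dots>, x\<^sub>m\<close> occur.
\<close>

type_synonym 'k mpoly = "(nat \<Rightarrow>\<^sub>0 nat) \<Rightarrow>\<^sub>0 'k"

definition Var :: "nat \<Rightarrow> 'k::comm_ring_1 mpoly" where
  "Var i = Poly_Mapping.single (Poly_Mapping.single i 1) 1"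

definition Const :: "'k::comm_ring_1 \<Rightarrow> 'k mpoly" where
  "Const c = Poly_Mapping.single 0 c"

definition vars :: "'k::comm_ring_1 mpoly \<Rightarrow> nat set" where
  "vars p = (\<Union>t\<in>Poly_Mapping.keys p. Poly_Mapping.keys t)"

definition poly_ring :: "nat \<Rightarrow> 'k::comm_ring_1 mpoly ring" where
  "poly_ring m =
     \<lparr>carrier = {p. vars p \<subseteq> {1..m}}, mult = (*), one = 1, zero = 0, add = (+)\<rparr>"

text \<open>
  Functions \<open>[n] \<rightarrow> [m]\<close> are extensional, that is, they take the value \<open>undefined\<close>
  outside \<open>[n]\<close>.
\<close>

definition Inc :: "nat \<Rightarrow> nat \<Rightarrow> (nat \<Rightarrow> nat) set" where
  "Inc n m = {\<pi> \<in> {1..n} \<rightarrow>\<^sub>E {1..m}. strict_mono_on {1..n} \<pi>}"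

text \<open>
  The substitution \<open>x\<^sub>i \<mapsto> x\<^bsub>\<pi>(i)\<^esub>\<close>. It is defined on all polynomials, but only its
  restriction to \<open>R\<^sub>n\<close> is of interest when \<open>\<pi>\<close> is a function on \<open>[n]\<close>.
\<close>

definition induced :: "(nat \<Rightarrow> nat) \<Rightarrow> 'k::comm_ring_1 mpoly \<Rightarrow> 'k mpoly" where
  "induced \<pi> p =
     (\<Sum>t\<in>Poly_Mapping.keys p. Const (Poly_Mapping.lookup p t) *
        (\<Prod>i\<in>Poly_Mapping.keys t. Var (\<pi> i) ^ Poly_Mapping.lookup t i))"

definition Inc_ideal :: "nat \<Rightarrow> nat \<Rightarrow> 'k::comm_ring_1 mpoly set \<Rightarrow> 'k mpoly set" where
  "Inc_ideal n m I = genideal (poly_ring m) (\<Union>\<pi>\<in>Inc n m. induced \<pi> ` I)"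

text \<open>
  A simple graph on \<open>[n]\<close> is given by its set of edges, which are two-element subsets of \<open>[n]\<close>.
\<close>

definition simple_graph :: "nat \<Rightarrow> nat set set \<Rightarrow> bool" where
  "simple_graph n E \<longleftrightarrow> (\<forall>e\<in>E. e \<subseteq> {1..n} \<and> card e = 2)"

definition edge_ideal :: "nat \<Rightarrow> nat set set \<Rightarrow> 'k::comm_ring_1 mpoly set" where
  "edge_ideal n E = genideal (poly_ring n) {Var i * Var j | i j. {i, j} \<in> E}"

definition line_graph :: "nat \<Rightarrow> nat set set" where
  "line_graph n = {{i, i + 1} | i. 1 \<le> i \<and> i \<le> n - 1}"


lemma simple_graph_line_graph: "simple_graph n (line_graph n)"
  by (auto simp: simple_graph_def line_graph_def)

lemma edge_ideal_line_graph:
  "(edge_ideal n (line_graph n) :: 'k::comm_ring_1 mpoly set) =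
     genideal (poly_ring n) {Var i * Var (i + 1) | i. 1 \<le> i \<and> i \<le> n - 1}"
proof -
  have "{Var i * Var j :: 'k mpoly | i j. {i, j} \<in> line_graph n} =
        {Var i * Var (i + 1) | i. 1 \<le> i \<and> i \<le> n - 1}"
    unfolding line_graph_def
    by (auto simp: doubleton_eq_iff mult.commute)
  then show ?thesis
    by (simp only: edge_ideal_def)
qed

lemma vars_add: "vars (p + q) \<subseteq> vars p \<union> vars q"
  using Poly_Mapping.keys_add[of p q] by (fastforce simp: vars_def)

lemma vars_uminus [simp]: "vars (- p) = vars p"
  by (simp add: vars_def keys_minus)

lemma vars_zero [simp]: "vars 0 = {}" and vars_one [simp]: "vars 1 = {}"
  by (auto simp: vars_def)

lemma vars_Const [simp]: "vars (Const c) = {}"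
  by (auto simp: vars_def Const_def)

lemma vars_Var [simp]: "vars (Var i :: 'k::comm_ring_1 mpoly) = {i}"
  by (simp add: vars_def Var_def)

lemma vars_mult: "vars (p * q) \<subseteq> vars p \<union> vars q"
proof
  fix v assume "v \<in> vars (p * q)"
  then obtain t where t: "t \<in> Poly_Mapping.keys (p * q)" "v \<in> Poly_Mapping.keys t"
    by (auto simp: vars_def)
  then obtain a b where "a \<in> Poly_Mapping.keys p" "b \<in> Poly_Mapping.keys q" "t = a + b"
    using keys_mult[of p q] by blast
  with t Poly_Mapping.keys_add[of a b] show "v \<in> vars p \<union> vars q"
    by (auto simp: vars_def)
qed

lemma poly_ring_simps [simp]:
  "carrier (poly_ring m) = {p. vars p \<subseteq> {1..m}}"
  "x \<otimes>\<^bsub>poly_ring m\<^esub> y = x * y" "\<one>\<^bsub>poly_ring m\<^esub> = 1"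
  "x \<oplus>\<^bsub>poly_ring m\<^esub> y = x + y" "\<zero>\<^bsub>poly_ring m\<^esub> = 0"
  by (simp_all add: poly_ring_def)

lemma cring_poly_ring: "cring (poly_ring m :: 'k::comm_ring_1 mpoly ring)"
proof (rule cringI)
  show "abelian_group (poly_ring m :: 'k mpoly ring)"
  proof (rule abelian_groupI)
    fix x :: "'k mpoly" assume "x \<in> carrier (poly_ring m)"
    then show "\<exists>y\<in>carrier (poly_ring m). y \<oplus>\<^bsub>poly_ring m\<^esub> x = \<zero>\<^bsub>poly_ring m\<^esub>"
      by (intro bexI[of _ "- x"]) auto
  next
    fix x y :: "'k mpoly" assume "x \<in> carrier (poly_ring m)" "y \<in> carrier (poly_ring m)"
    then show "x \<oplus>\<^bsub>poly_ring m\<^esub> y \<in> carrier (poly_ring m)"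
      using vars_add[of x y] by auto
  qed (auto simp: algebra_simps)
  show "comm_monoid (poly_ring m :: 'k mpoly ring)"
  proof (rule comm_monoidI)
    fix x y :: "'k mpoly" assume "x \<in> carrier (poly_ring m)" "y \<in> carrier (poly_ring m)"
    then show "x \<otimes>\<^bsub>poly_ring m\<^esub> y \<in> carrier (poly_ring m)"
      using vars_mult[of x y] by auto
  qed (auto simp: algebra_simps)
qed (simp add: algebra_simps)

lemma induced_superset:
  assumes "finite A" "Poly_Mapping.keys p \<subseteq> A"
  shows "induced \<pi> p = (\<Sum>t\<in>A. Const (Poly_Mapping.lookup p t) *
           (\<Prod>i\<in>Poly_Mapping.keys t. Var (\<pi> i) ^ Poly_Mapping.lookup t i))"
  unfolding induced_def using assms
  by (intro sum.mono_neutral_left) (auto simp: in_keys_iff Const_def)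

lemma Const_add: "Const (a + b) = Const a + Const b"
  by (simp add: Const_def single_add)

lemma Const_mult: "Const (a * b) = Const a * Const b"
  by (simp add: Const_def mult_single)

lemma induced_zero [simp]: "induced \<pi> 0 = 0"
  by (simp add: induced_def)

lemma induced_add: "induced \<pi> (p + q) = induced \<pi> p + induced \<pi> q"
proof -
  let ?A = "Poly_Mapping.keys p \<union> Poly_Mapping.keys q"
  have "finite ?A" "Poly_Mapping.keys (p + q) \<subseteq> ?A"
    using Poly_Mapping.keys_add[of p q] by auto
  then show ?thesis
    by (simp add: induced_superset[of ?A] lookup_add Const_add ring_distribs sum.distrib)
qed

lemma induced_single:
  "induced \<pi> (Poly_Mapping.single t c) =
     Const c * (\<Prod>i\<in>Poly_Mapping.keys t. Var (\<pi> i) ^ Poly_Mapping.lookup t i)"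
  by (subst induced_superset[of "{t}"]) auto

lemma induced_Const [simp]: "induced \<pi> (Const c) = Const c"
  using induced_single[of \<pi> 0 c] by (simp add: Const_def)

lemma induced_Var [simp]: "induced \<pi> (Var i) = Var (\<pi> i)"
  unfolding Var_def[of i] by (simp add: induced_single) (simp add: Const_def)

lemma mpoly_induct [case_names zero add]:
  fixes p :: "'k::comm_ring_1 mpoly"
  assumes "P 0" and "\<And>t c p. P p \<Longrightarrow> P (Poly_Mapping.single t c + p)"
  shows "P p"
proof (induction p rule: update_induct)
  case const
  show ?case by fact
next
  case (update p t c)
  then have "Poly_Mapping.update t c p = Poly_Mapping.single t c + p"
    by (intro poly_mapping_eqI)
      (auto simp: lookup_update lookup_add lookup_single in_keys_iff when_def)
  with update assms(2) show ?case by simp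
qed

lemma monomial_image_add:
  fixes s t :: "nat \<Rightarrow>\<^sub>0 nat" and f :: "nat \<Rightarrow> 'a::comm_monoid_mult"
  shows "(\<Prod>i\<in>Poly_Mapping.keys (s + t). f i ^ Poly_Mapping.lookup (s + t) i) =
    (\<Prod>i\<in>Poly_Mapping.keys s. f i ^ Poly_Mapping.lookup s i) *
    (\<Prod>i\<in>Poly_Mapping.keys t. f i ^ Poly_Mapping.lookup t i)"
proof -
  let ?A = "Poly_Mapping.keys s \<union> Poly_Mapping.keys t"
  have *: "(\<Prod>i\<in>Poly_Mapping.keys u. f i ^ Poly_Mapping.lookup u i) =
        (\<Prod>i\<in>?A. f i ^ Poly_Mapping.lookup u i)"
    if "Poly_Mapping.keys u \<subseteq> ?A" for u
    using that by (intro prod.mono_neutral_left) (auto simp: in_keys_iff)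
  show ?thesis
    unfolding *[OF Poly_Mapping.keys_add] *[of s, simplified] *[of t, simplified]
    by (simp add: lookup_add power_add prod.distrib)
qed

lemma induced_mult: "induced \<pi> (p * q) = induced \<pi> p * induced \<pi> q"
proof -
  have single: "induced \<pi> (Poly_Mapping.single s a * Poly_Mapping.single t b) =
      induced \<pi> (Poly_Mapping.single s a) * induced \<pi> (Poly_Mapping.single t b)"
    for s t :: "nat \<Rightarrow>\<^sub>0 nat" and a b :: 'a
    by (simp add: mult_single induced_single monomial_image_add Const_mult algebra_simps)
  have "induced \<pi> (Poly_Mapping.single s a * q) =
      induced \<pi> (Poly_Mapping.single s a) * induced \<pi> q" for s a
    by (induction q rule: mpoly_induct) (simp_all add: single ring_distribs induced_add)
  then show ?thesis
    by (induction p rule: mpoly_induct) (simp_all add: ring_distribs induced_add)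
qed

lemma vars_sum: "vars (sum f A) \<subseteq> (\<Union>a\<in>A. vars (f a))"
proof (induction A rule: infinite_finite_induct)
  case (insert a A)
  then show ?case using vars_add[of "f a" "sum f A"] by auto
qed auto

lemma vars_prod: "vars (prod f A) \<subseteq> (\<Union>a\<in>A. vars (f a))"
proof (induction A rule: infinite_finite_induct)
  case (insert a A)
  then show ?case using vars_mult[of "f a" "prod f A"] by auto
qed auto

lemma vars_power: "vars (p ^ e) \<subseteq> vars p"
proof (induction e)
  case (Suc e)
  then show ?case using vars_mult[of p "p ^ e"] by auto
qed auto

lemma vars_induced: "vars (induced \<pi> p) \<subseteq> \<pi> ` vars p"
proof -
  have "vars (Const c * (\<Prod>i\<in>Poly_Mapping.keys t. Var (\<pi> i) ^ Poly_Mapping.lookup t i))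
      \<subseteq> \<pi> ` Poly_Mapping.keys t" for c :: 'a and t
  proof -
    let ?f = "\<lambda>i. (Var (\<pi> i) :: 'a mpoly) ^ Poly_Mapping.lookup t i"
    have "vars (Const c * prod ?f (Poly_Mapping.keys t)) \<subseteq> vars (prod ?f (Poly_Mapping.keys t))"
      using vars_mult[of "Const c"] by simp
    also have "\<dots> \<subseteq> (\<Union>i\<in>Poly_Mapping.keys t. vars (?f i))"
      by (rule vars_prod)
    also have "\<dots> \<subseteq> (\<Union>i\<in>Poly_Mapping.keys t. {\<pi> i})"
    proof (intro UN_mono order_refl)
      fix i show "vars (?f i) \<subseteq> {\<pi> i}"
        by (metis vars_power vars_Var)
    qed
    finally show ?thesis by auto
  qed
  then have "vars (induced \<pi> p) \<subseteq> (\<Union>t\<in>Poly_Mapping.keys p. \<pi> ` Poly_Mapping.keys t)"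
    unfolding induced_def by (intro order_trans[OF vars_sum] UN_mono order_refl)
  then show ?thesis unfolding vars_def by (simp add: image_UN)
qed

lemma induced_closed:
  assumes "\<pi> \<in> Inc n m" "p \<in> carrier (poly_ring n)"
  shows "induced \<pi> p \<in> carrier (poly_ring m)"
proof -
  have "\<pi> ` {1..n} \<subseteq> {1..m}" using assms(1) by (auto simp: Inc_def)
  with assms(2) vars_induced[of \<pi> p] show ?thesis
    unfolding poly_ring_simps(1) mem_Collect_eq by (meson image_mono order_trans)
qed

lemma induced_ring_hom:
  assumes "\<pi> \<in> Inc n m"
  shows "induced \<pi> \<in> ring_hom (poly_ring n) (poly_ring m)"
  using induced_Const[of \<pi> 1] induced_closed[OF assms]
  by (intro ring_hom_memI) (auto simp: induced_add induced_mult Const_def simp del: induced_Const)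

end

theory Submission
  imports Defs "HOL-Algebra.QuotRing"
begin

text \<open>
  A strictly increasing \<open>\<pi> : [n] \<rightarrow> [n + r]\<close> with \<open>\<pi> i = a\<close> and \<open>\<pi> (i + 1) = b\<close> has to fit
  \<open>i - 1\<close> values below \<open>a\<close> and \<open>n - i - 1\<close> values above \<open>b\<close>, and nothing else obstructs it: such a
  \<open>\<pi>\<close> exists iff \<open>i \<le> a < b \<le> i + r + 1\<close> (\<open>Inc_consecutive_values_iff\<close>). The edge \<open>{i, i + 1}\<close>
  is arbitrary, and the upper bound on \<open>b\<close> is weakest for the largest admissible \<open>i\<close>,
  which is \<open>min a (n - 1)\<close>. So for \<open>1 \<le> a < b\<close> the monomial \<open>x\<^sub>a x\<^sub>b\<close> is the image of
  an edge monomial iff \<open>b \<le> min a (n - 1) + r + 1\<close>. For \<open>a \<le> n - 2\<close> this is the bound in the first family of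
  generators, for \<open>a \<ge> n - 1\<close> it is \<open>b \<le> n + r\<close>, as in the second family.

  It remains to see that looking at the images of generators is enough: since every \<open>\<pi>\<close> induces a
  ring homomorphism, the preimage of an ideal is an ideal, so an ideal of \<open>R\<^sub>m\<close> that contains the
  images of a generating set of \<open>I\<close> contains the image of \<open>I\<close> (\<open>Inc_ideal_genideal\<close>).
\<close>

text \<open>
  Ideals pull back to ideals along \<open>\<pi>\<close>. The images of the generators therefore already generate
  everything, although \<open>\<pi>(I)\<close> itself is in general not an ideal of \<open>R\<^sub>m\<close>.
\<close>

lemma Inc_ideal_genideal:
  fixes S :: "'k::comm_ring_1 mpoly set"
  assumes S: "S \<subseteq> carrier (poly_ring n)"
  shows "Inc_ideal n m (genideal (poly_ring n) S) =
    genideal (poly_ring m) (\<Union>\<pi>\<in>Inc n m. induced \<pi> ` S)"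
proof -
  interpret Rn: cring "poly_ring n :: 'k mpoly ring" by (rule cring_poly_ring)
  interpret Rm: cring "poly_ring m :: 'k mpoly ring" by (rule cring_poly_ring)
  let ?I = "genideal (poly_ring n) S"
  let ?T = "\<Union>\<pi>\<in>Inc n m. induced \<pi> ` S"
  let ?J = "genideal (poly_ring m) ?T"
  have T: "?T \<subseteq> carrier (poly_ring m)"
    using S induced_closed by blast
  have "S \<subseteq> ?I"
    by (rule Rn.genideal_self[OF S])
  have I: "?I \<subseteq> carrier (poly_ring n)"
    using Rn.genideal_ideal[OF S] by (rule additive_subgroup.a_subset[OF ideal.axioms(1)])
  have U: "(\<Union>\<pi>\<in>Inc n m. induced \<pi> ` ?I) \<subseteq> carrier (poly_ring m)"
    using I induced_closed by blast
  have "induced \<pi> ` ?I \<subseteq> ?J" if \<pi>: "\<pi> \<in> Inc n m" for \<pi>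
  proof -
    interpret hom: ring_hom_ring "poly_ring n" "poly_ring m" "induced \<pi> :: 'k mpoly \<Rightarrow> _"
      by (intro ring_hom_ringI2 Rn.ring_axioms Rm.ring_axioms induced_ring_hom \<pi>)
    have "ideal {p \<in> carrier (poly_ring n). induced \<pi> p \<in> ?J} (poly_ring n)"
      by (rule hom.ideal_vimage[OF Rm.genideal_ideal[OF T]])
    moreover have "S \<subseteq> {p \<in> carrier (poly_ring n). induced \<pi> p \<in> ?J}"
      using S \<pi> Rm.genideal_self[OF T] by blast
    ultimately have "?I \<subseteq> {p \<in> carrier (poly_ring n). induced \<pi> p \<in> ?J}"
      by (rule Rn.genideal_minimal)
    then show ?thesis by blast
  qed
  then have "Inc_ideal n m ?I \<subseteq> ?J"
    unfolding Inc_ideal_def by (intro Rm.genideal_minimal Rm.genideal_ideal[OF T]) blast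
  moreover have "?J \<subseteq> Inc_ideal n m ?I"
    unfolding Inc_ideal_def
    using \<open>S \<subseteq> ?I\<close> Rm.genideal_self[OF U]
    by (intro Rm.genideal_minimal Rm.genideal_ideal[OF U]) blast
  ultimately show ?thesis by (rule subset_antisym)
qed

text \<open>
  Each step raises the value by at least one. Applied from \<open>1\<close> to \<open>i\<close> and from \<open>i + 1\<close> to \<open>n\<close>, this
  bounds two consecutive values by the room left for the values before and after them.
\<close>

lemma strict_mono_on_interval_ge:
  fixes \<pi> :: "nat \<Rightarrow> nat"
  assumes "strict_mono_on {1..n} \<pi>" and "1 \<le> i" and "i \<le> j" and "j \<le> n"
  shows "\<pi> i + (j - i) \<le> \<pi> j"
  using \<open>i \<le> j\<close> \<open>j \<le> n\<close>
proof (induction j rule: dec_induct)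
  case (step j)
  then have "\<pi> j < \<pi> (Suc j)"
    using assms(1,2) by (auto dest!: strict_mono_onD[of _ _ j "Suc j"])
  with step show ?case by simp
qed simp

lemma Inc_consecutive_values_iff:
  assumes i: "1 \<le> i" "i < n"
  shows "(\<exists>\<pi>\<in>Inc n (n + r). \<pi> i = a \<and> \<pi> (i + 1) = b) \<longleftrightarrow> i \<le> a \<and> a < b \<and> b \<le> i + r + 1"
proof
  assume "\<exists>\<pi>\<in>Inc n (n + r). \<pi> i = a \<and> \<pi> (i + 1) = b"
  then obtain \<pi> where \<pi>: "\<pi> \<in> {1..n} \<rightarrow>\<^sub>E {1..n + r}" "strict_mono_on {1..n} \<pi>"
    and ab: "\<pi> i = a" "\<pi> (i + 1) = b"
    by (auto simp: Inc_def)
  have "1 \<le> \<pi> 1" "\<pi> n \<le> n + r"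
    using PiE_mem[OF \<pi>(1), of 1] PiE_mem[OF \<pi>(1), of n] i by auto
  moreover have "\<pi> 1 + (i - 1) \<le> a" "a + 1 \<le> b" "b + (n - (i + 1)) \<le> \<pi> n"
    using strict_mono_on_interval_ge[OF \<pi>(2), of 1 i]
      strict_mono_on_interval_ge[OF \<pi>(2), of i "i + 1"]
      strict_mono_on_interval_ge[OF \<pi>(2), of "i + 1" n] i ab by auto
  ultimately show "i \<le> a \<and> a < b \<and> b \<le> i + r + 1"
    using i by linarith
next
  assume ab: "i \<le> a \<and> a < b \<and> b \<le> i + r + 1"
  \<comment> \<open>Values before \<open>i\<close> are as small as possible, those after \<open>i + 1\<close> follow \<open>b\<close> without gaps.\<close>
  define \<pi> where "\<pi> = (\<lambda>k\<in>{1..n}. if k < i then k else if k = i then a else k + b - (i + 1))"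
  have "\<pi> \<in> Inc n (n + r)"
    using i ab by (auto simp: \<pi>_def Inc_def intro!: strict_mono_onI)
  moreover have "\<pi> i = a" "\<pi> (i + 1) = b"
    using i by (simp_all add: \<pi>_def)
  ultimately show "\<exists>\<pi>\<in>Inc n (n + r). \<pi> i = a \<and> \<pi> (i + 1) = b"
    by blast
qed

theorem lemma3p1:
  fixes n r :: nat
  assumes "n \<ge> 3" and "r \<ge> 1"
  shows "(Inc_ideal n (n + r) (edge_ideal n (line_graph n)) :: 'k::field mpoly set) =
    genideal (poly_ring (n + r))
      ({Var i * Var j | i j. 1 \<le> i \<and> i \<le> n - 2 \<and> i < j \<and> j \<le> i + r + 1} \<union>
       {Var i * Var j | i j. n - 1 \<le> i \<and> i \<le> n + r - 1 \<and> i < j \<and> j \<le> n + r})"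
proof -
  let ?S = "{Var i * Var (i + 1) :: 'k mpoly | i. 1 \<le> i \<and> i \<le> n - 1}"
  let ?ok = "\<lambda>a b. (1 \<le> a \<and> a \<le> n - 2 \<and> a < b \<and> b \<le> a + r + 1) \<or>
    (n - 1 \<le> a \<and> a \<le> n + r - 1 \<and> a < b \<and> b \<le> n + r)"
  have "vars (Var i * Var (i + 1) :: 'k mpoly) \<subseteq> {1..n}" if "1 \<le> i" "i \<le> n - 1" for i
    using vars_mult[of "Var i :: 'k mpoly" "Var (i + 1)"] that by auto
  then have S: "?S \<subseteq> carrier (poly_ring n)"
    unfolding poly_ring_simps(1) by blast
  have ok: "(\<exists>i. 1 \<le> i \<and> i \<le> n - 1 \<and> (\<exists>\<pi>\<in>Inc n (n + r). \<pi> i = a \<and> \<pi> (i + 1) = b)) \<longleftrightarrow> ?ok a b"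
    for a b
  proof -
    have "(\<exists>i. 1 \<le> i \<and> i \<le> n - 1 \<and> (\<exists>\<pi>\<in>Inc n (n + r). \<pi> i = a \<and> \<pi> (i + 1) = b)) \<longleftrightarrow>
        (\<exists>i. 1 \<le> i \<and> i \<le> n - 1 \<and> i \<le> a \<and> a < b \<and> b \<le> i + r + 1)"
    proof (intro ex_cong1 conj_cong refl)
      fix i assume "1 \<le> i" "i \<le> n - 1"
      with \<open>n \<ge> 3\<close> show "(\<exists>\<pi>\<in>Inc n (n + r). \<pi> i = a \<and> \<pi> (i + 1) = b) \<longleftrightarrow>
          i \<le> a \<and> a < b \<and> b \<le> i + r + 1"
        by (intro Inc_consecutive_values_iff) auto
    qed
    also have "\<dots> \<longleftrightarrow> ?ok a b"
    proof
      assume "?ok a b"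
      \<comment> \<open>The largest \<open>i\<close> with \<open>i \<le> a\<close> and \<open>i \<le> n - 1\<close> makes the bound on \<open>b\<close> weakest.\<close>
      with \<open>n \<ge> 3\<close> show "\<exists>i. 1 \<le> i \<and> i \<le> n - 1 \<and> i \<le> a \<and> a < b \<and> b \<le> i + r + 1"
        by (intro exI[of _ "min a (n - 1)"]) auto
    qed (use \<open>n \<ge> 3\<close> in auto)
    finally show ?thesis .
  qed
  have "(\<Union>\<pi>\<in>Inc n (n + r). induced \<pi> ` ?S) =
      {Var a * Var b | a b. \<exists>i. 1 \<le> i \<and> i \<le> n - 1 \<and>
        (\<exists>\<pi>\<in>Inc n (n + r). \<pi> i = a \<and> \<pi> (i + 1) = b)}"
    by (auto simp: induced_mult image_iff; metis induced_mult induced_Var)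
  also have "\<dots> = {Var a * Var b | a b. ?ok a b}"
    unfolding ok ..
  finally show ?thesis
    unfolding edge_ideal_line_graph Inc_ideal_genideal[OF S]
    by (simp only: Collect_disj_eq ex_disj_distrib conj_disj_distribL)
qed

end
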